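(* For every integer $n\ge 1$, $$B_{2n}=\frac{2n}{2^{2n}(2^{2n}-1)}\sum_{k=0}^{n-1}\binom{2n-1}{2k}E_{2k}.$$
   Context: The Bernoulli numbers $B_m$ are defined by $\frac{x}{e^x-1}=\sum_{m=0}^\infty B_m\frac{x^m}{m!}$ for $|x|<2\pi$. The Euler numbers $E_m$ are defined by $\frac{1}{\cosh t}=\sum_{m=0}^\infty E_m\frac{t^m}{m!}$ for $|t|<\pi/2$ (so $E_0=1$, $E_2=-1$, $E_4=5$, $E_6=-61$, and odd-index Euler numbers vanish). *)

theory Defs
  imports "HOL-Complex_Analysis.Complex_Analysis"
begin

(* The function x / (e^x - 1) takes the value 1 at its removable singularity 0; in HOL, 0 / 0 = 0. *)
definition bernoulli_gf :: "'a::{real_normed_field,banach} \<Rightarrow> 'a"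
  where "bernoulli_gf x = (if x = 0 then 1 else x / (exp x - 1))"

definition bernoulli_number :: "nat \<Rightarrow> real"
  where "bernoulli_number =
    (THE B. \<forall>x::real. \<bar>x\<bar> < 2 * pi \<longrightarrow> (\<lambda>m. B m * (x ^ m / fact m)) sums bernoulli_gf x)"

definition euler_number :: "nat \<Rightarrow> real"
  where "euler_number =
    (THE E. \<forall>t::real. \<bar>t\<bar> < pi / 2 \<longrightarrow> (\<lambda>m. E m * (t ^ m / fact m)) sums (1 / cosh t))"

lemma egf_ex1:
  fixes f :: "real \<Rightarrow> real" and g :: "complex \<Rightarrow> complex"
  assumes r: "r > 0"
    and hol: "g holomorphic_on ball 0 r"
    and fg: "\<And>x. \<bar>x\<bar> < r \<Longrightarrow> g (of_real x) = of_real (f x)"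
  shows "\<exists>!a. \<forall>x::real. \<bar>x\<bar> < r \<longrightarrow> (\<lambda>m. a m * (x ^ m / fact m)) sums f x"
proof (rule ex_ex1I)
  show "\<exists>a. \<forall>x::real. \<bar>x\<bar> < r \<longrightarrow> (\<lambda>m. a m * (x ^ m / fact m)) sums f x"
  proof (intro exI allI impI)
    fix x :: real
    assume x: "\<bar>x\<bar> < r"
    have "(\<lambda>m. (deriv ^^ m) g 0 / fact m * (of_real x - 0) ^ m) sums g (of_real x)"
      using x by (intro holomorphic_power_series[OF hol]) auto
    then have "(\<lambda>m. Re ((deriv ^^ m) g 0 / fact m * (of_real x - 0) ^ m)) sums Re (g (of_real x))"
      by (rule sums_Re)
    moreover have "Re ((deriv ^^ m) g 0 / fact m * (of_real x - 0) ^ m)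
        = Re ((deriv ^^ m) g 0) * (x ^ m / fact m)" for m
    proof -
      have "(deriv ^^ m) g 0 / fact m * (of_real x - 0) ^ m
          = of_real (x ^ m / fact m) * (deriv ^^ m) g 0"
        by simp
      then show ?thesis
        by (simp only: Re_complex_of_real Im_complex_of_real times_complex.sel) simp
    qed
    ultimately show "(\<lambda>m. Re ((deriv ^^ m) g 0) * (x ^ m / fact m)) sums f x"
      using fg[OF x] by simp
  qed
next
  fix a b :: "nat \<Rightarrow> real"
  assume a: "\<forall>x. \<bar>x\<bar> < r \<longrightarrow> (\<lambda>m. a m * (x ^ m / fact m)) sums f x"
    and b: "\<forall>x. \<bar>x\<bar> < r \<longrightarrow> (\<lambda>m. b m * (x ^ m / fact m)) sums f x"
  have d: "(\<lambda>m. ((a m - b m) / fact m) * x ^ m) sums 0" if "norm x < r" for x :: real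
    using sums_diff[OF a[rule_format, of x] b[rule_format, of x]] that
    by (simp add: field_simps)
  show "a = b"
  proof
    fix m
    have "(a m - b m) / fact m = 0"
    proof (rule ccontr)
      assume nz: "(a m - b m) / fact m \<noteq> 0"
      define c where "c = (\<lambda>m. (a m - b m) / fact m)"
      define n where "n = (LEAST m. c m \<noteq> 0)"
      have n: "c n \<noteq> 0"
        unfolding n_def by (rule LeastI[of _ m]) (use nz in \<open>simp add: c_def\<close>)
      have less: "c i = 0" if "i < n" for i
        using that not_less_Least unfolding n_def by blast
      have sh: "(\<lambda>i. c (i + n) * x ^ i) sums 0" if "norm x < r" "x \<noteq> 0" for x :: real
      proof -
        have "(\<lambda>i. c (i + n) * x ^ (i + n)) sums 0"
          using d[OF that(1)] sums_iff_shift[of "\<lambda>i. c i * x ^ i" n 0] less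
          by (simp add: c_def)
        then have "(\<lambda>i. (c (i + n) * x ^ (i + n)) / x ^ n) sums (0 / x ^ n)"
          by (rule sums_divide)
        then show ?thesis
          using that by (simp add: power_add)
      qed
      have "((\<lambda>_. 0) \<longlongrightarrow> c (0 + n)) (at (0::real))"
        using r by (intro powser_limit_0_strong[of r "\<lambda>i. c (i + n)" "\<lambda>_. 0"] sh) auto
      then have "c n = 0"
        by (simp add: tendsto_const_iff)
      with n show False by simp
    qed
    then show "a m = b m" by simp
  qed
qed

lemma bernoulli_gf_holomorphic: "bernoulli_gf holomorphic_on ball (0::complex) (2 * pi)"
proof -
  have deriv_exp: "deriv exp (0::complex) = 1"
    using DERIV_imp_deriv[OF DERIV_exp[of "0::complex"]] by simp
  define h where "h = (\<lambda>z::complex. if z = 0 then deriv exp 0 else exp z / z - exp 0 / (z - 0))"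
  have "h holomorphic_on ball 0 (2 * pi)"
    unfolding h_def by (rule pole_theorem) (auto intro: holomorphic_intros)
  moreover have "h z \<noteq> 0" if "z \<in> ball 0 (2 * pi)" for z
  proof (cases "z = 0")
    case True
    then show ?thesis by (simp add: h_def deriv_exp)
  next
    case False
    have "exp z \<noteq> 1"
    proof
      assume "exp z = 1"
      then obtain n :: int where n: "Re z = 0" "Im z = of_int (2 * n) * pi"
        by (auto simp: exp_eq_1)
      with False have "n \<noteq> 0"
        by (auto simp: complex_eq_iff)
      then have "1 * (2 * pi) \<le> \<bar>of_int n\<bar> * (2 * pi)"
        by (intro mult_right_mono) (auto simp flip: of_int_abs)
      also have "\<dots> = \<bar>Im z\<bar>"
        by (simp add: n abs_mult)
      also have "\<dots> \<le> norm z"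
        by (rule abs_Im_le_cmod)
      finally show False
        using that by simp
    qed
    with False show ?thesis
      by (simp add: h_def)
  qed
  ultimately have "(\<lambda>z. 1 / h z) holomorphic_on ball 0 (2 * pi)"
    by (intro holomorphic_intros) auto
  moreover have "(\<lambda>z. 1 / h z) = bernoulli_gf"
    by (auto simp: h_def deriv_exp bernoulli_gf_def fun_eq_iff simp flip: diff_divide_distrib)
  ultimately show ?thesis by simp
qed

lemma sech_holomorphic: "(\<lambda>z::complex. 1 / cosh z) holomorphic_on ball 0 (pi / 2)"
proof -
  have "cosh z \<noteq> 0" if "z \<in> ball 0 (pi / 2)" for z :: complex
  proof
    assume "cosh z = 0"
    then have "cos (\<i> * z) = 0"
      by (simp add: cosh_conv_cos)
    then obtain n :: int where n: "\<i> * z = of_real (of_int n * pi + pi / 2)"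
      by (auto simp: cos_eq_0)
    have "norm z = norm (\<i> * z)"
      by (simp add: norm_mult)
    also have "\<dots> = \<bar>of_int n * pi + pi / 2\<bar>"
      unfolding n by (rule norm_of_real)
    also have "of_int n * pi + pi / 2 = of_int (2 * n + 1) * (pi / 2)"
      by (simp add: field_simps)
    also have "\<bar>\<dots>\<bar> = of_int \<bar>2 * n + 1\<bar> * (pi / 2)"
      by (simp add: abs_mult)
    also have "\<dots> \<ge> 1 * (pi / 2)"
    proof (rule mult_right_mono)
      have "1 \<le> \<bar>2 * n + 1\<bar>" by presburger
      then show "1 \<le> real_of_int \<bar>2 * n + 1\<bar>" by linarith
    qed simp
    finally show False
      using that by simp
  qed
  moreover have "(cosh :: complex \<Rightarrow> complex) holomorphic_on ball 0 (pi / 2)"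
    unfolding cosh_def[abs_def] by (intro holomorphic_intros)
  ultimately show ?thesis
    by (intro holomorphic_intros) auto
qed

lemma bernoulli_number_ex1:
  "\<exists>!B. \<forall>x::real. \<bar>x\<bar> < 2 * pi \<longrightarrow> (\<lambda>m. B m * (x ^ m / fact m)) sums bernoulli_gf x"
  by (rule egf_ex1[OF _ bernoulli_gf_holomorphic])
     (auto simp: bernoulli_gf_def simp flip: exp_of_real)

lemma euler_number_ex1:
  "\<exists>!E. \<forall>t::real. \<bar>t\<bar> < pi / 2 \<longrightarrow> (\<lambda>m. E m * (t ^ m / fact m)) sums (1 / cosh t)"
  by (rule egf_ex1[OF _ sech_holomorphic])
     (auto simp: cosh_def scaleR_conv_of_real simp flip: exp_of_real)

lemma bernoulli_number_sums:
  "\<bar>x\<bar> < 2 * pi \<Longrightarrow> (\<lambda>m. bernoulli_number m * (x ^ m / fact m)) sums bernoulli_gf x"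
  using theI'[OF bernoulli_number_ex1] unfolding bernoulli_number_def by blast

lemma euler_number_sums:
  "\<bar>t\<bar> < pi / 2 \<Longrightarrow> (\<lambda>m. euler_number m * (t ^ m / fact m)) sums (1 / cosh t)"
  using theI'[OF euler_number_ex1] unfolding euler_number_def by blast

end

theory Submission
  imports Defs
begin

text \<open>
  Write \<open>b x = x / (exp x - 1)\<close>, with \<open>b 0 = 1\<close>, for the generating function of the Bernoulli
  numbers. The two sides of the theorem come from two computations of the coefficients of
  \<open>t * tanh t\<close>.

  On the one hand \<open>b x - b (2 * x) = x / (exp x + 1)\<close>, because \<open>exp (2 * x) - 1\<close> factors as
  \<open>(exp x - 1) * (exp x + 1)\<close>. With \<open>x = 2 * t\<close> this yields
  \<open>b (4 * t) - b (2 * t) = t * tanh t - t\<close> (lemma \<open>bernoulli_gf_tanh\<close>), so for \<open>n \<ge> 1\<close> the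
  coefficient of \<open>t ^ (2 * n)\<close> in \<open>t * tanh t\<close> is
  \<open>(4 ^ (2 * n) - 2 ^ (2 * n)) * B\<^sub>2\<^sub>n / (2 * n)!\<close>.

  On the other hand \<open>tanh t = (1 / cosh t) * sinh t\<close>. The odd part \<open>sinh\<close> of the exponential
  only lets the Euler numbers of even index contribute to the coefficient of \<open>t ^ (2 * n - 1)\<close>,
  and the Cauchy product produces the binomial sum divided by \<open>(2 * n - 1)!\<close>
  (lemma \<open>egf_times_sinh_nth\<close>). Comparing the two coefficients proves the identity. The comparison
  is made between formal power series, which are determined by the function that they represent
  near \<open>0\<close> (lemma \<open>has_fps_expansion_unique\<close>).
\<close>

text \<open>
  A nonzero power series without constant term has an isolated zero at the origin, so the difference
  of two expansions of the same function vanishes. Isolation of zeros holds over any complete normed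
  field, so this covers expansions that are only known on the real line.
\<close>

lemma has_fps_expansion_unique:
  fixes F G :: "'a :: {banach, real_normed_field} fps"
  assumes "f has_fps_expansion F" "f has_fps_expansion G"
  shows "F = G"
proof -
  define H where "H = F - G"
  have "(\<lambda>x. f x - f x) has_fps_expansion H"
    unfolding H_def by (intro has_fps_expansion_diff assms)
  then have radius: "fps_conv_radius H > 0"
    and ev: "eventually (\<lambda>x. eval_fps H x = 0) (nhds 0)"
    by (auto simp: has_fps_expansion_def)
  have H0: "fps_nth H 0 = 0"
    using eventually_nhds_x_imp_x[OF ev] by (simp add: eval_fps_at_0)
  obtain r where r: "r > 0" "ereal r < fps_conv_radius H"
    using ereal_dense2[OF radius] by (auto simp: zero_ereal_def)
  have "fps_nth H m = 0" for m
  proof (rule ccontr)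
    assume m: "fps_nth H m \<noteq> 0"
    have m_pos: "m > 0"
      using m H0 by (cases m) auto
    have sums: "(\<lambda>n. fps_nth H n * (x - 0) ^ n) sums eval_fps H x" if "norm (x - 0) < r" for x
    proof -
      have "ereal (norm x) < fps_conv_radius H"
        using that r(2) by (simp add: less_trans[of "ereal (norm x)" "ereal r"])
      then show ?thesis
        using sums_eval_fps[of x H] by simp
    qed
    obtain s where s: "s > 0" "\<And>z. z \<in> cball 0 s - {0} \<Longrightarrow> eval_fps H z \<noteq> 0"
      by (rule powser_0_nonzero[OF r(1) sums _ m m_pos]) (use H0 in \<open>auto simp: eval_fps_at_0\<close>)
    obtain d where d: "d > 0" "\<And>x. dist x 0 < d \<Longrightarrow> eval_fps H x = 0"
      using ev by (auto simp: eventually_nhds_metric)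
    define z where "z = (of_real (min s (d / 2)) :: 'a)"
    have "norm z = min s (d / 2)"
      using s(1) d(1) by (simp add: z_def)
    then have "z \<in> cball 0 s - {0}" "dist z 0 < d"
      using s(1) d(1) by (auto simp: z_def)
    with s(2) d(2) show False by blast
  qed
  then show ?thesis
    by (simp add: H_def fps_eq_iff)
qed

text \<open>
  The parameter \<open>c\<close> makes the dilated functions \<open>bernoulli_gf (2 * t)\<close> and
  \<open>bernoulli_gf (4 * t)\<close> available without composing formal series.
\<close>

lemma egf_dilation_has_fps_expansion:
  fixes a :: "nat \<Rightarrow> real"
  assumes r: "r > 0" and c: "c > 0"
    and sums: "\<And>x. \<bar>x\<bar> < r \<Longrightarrow> (\<lambda>m. a m * (x ^ m / fact m)) sums f x"
  shows "(\<lambda>x. f (c * x)) has_fps_expansion Abs_fps (\<lambda>m. c ^ m * a m / fact m)"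
proof -
  let ?F = "Abs_fps (\<lambda>m. c ^ m * a m / fact m)"
  have F: "(\<lambda>m. fps_nth ?F m * x ^ m) sums f (c * x)" if "\<bar>x\<bar> < r / c" for x
  proof -
    have "\<bar>c * x\<bar> < r"
      using that c by (simp add: abs_mult field_simps)
    from sums[OF this] show ?thesis
      by (simp add: power_mult_distrib mult_ac)
  qed
  have "0 < ereal (norm (r / c / 2))"
    using r c by simp
  also have "\<dots> \<le> fps_conv_radius ?F"
    unfolding fps_conv_radius_def
    by (intro conv_radius_geI sums_summable[OF F]) (use r c in \<open>simp add: field_simps\<close>)
  finally have "fps_conv_radius ?F > 0" .
  moreover have "eventually (\<lambda>x. eval_fps ?F x = f (c * x)) (nhds 0)"
  proof -
    have "eventually (\<lambda>x. x \<in> ball 0 (r / c)) (nhds (0 :: real))"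
      using r c by (intro eventually_nhds_in_open) auto
    then show ?thesis
      by eventually_elim (auto simp: eval_fps_def dest!: F intro: sums_unique[symmetric])
  qed
  ultimately show ?thesis
    by (simp add: has_fps_expansion_def)
qed

lemma bernoulli_gf_tanh:
  fixes t :: real
  shows "bernoulli_gf (4 * t) - bernoulli_gf (2 * t) = t * ((1 / cosh t) * sinh t) - t"
proof (cases "t = 0")
  case True
  then show ?thesis by (simp add: bernoulli_gf_def)
next
  case False
  define q where "q = exp t"
  have q: "q > 0" "q \<noteq> 1"
    using False by (auto simp: q_def)
  have powers: "exp (2 * t) = q\<^sup>2" "exp (4 * t) = q ^ 4" "exp (- t) = 1 / q"
    unfolding q_def by (simp_all add: exp_minus field_simps flip: exp_of_nat_mult)
  have q2: "q\<^sup>2 - 1 \<noteq> 0" "q\<^sup>2 + 1 \<noteq> 0"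
    using q by (auto simp: power2_eq_1_iff add_nonneg_eq_0_iff)
  have q4: "q ^ 4 - 1 = (q\<^sup>2 - 1) * (q\<^sup>2 + 1)"
    by (simp add: algebra_simps flip: power_add)
  have "bernoulli_gf (4 * t) - bernoulli_gf (2 * t)
      = 4 * t / ((q\<^sup>2 - 1) * (q\<^sup>2 + 1)) - 2 * t / (q\<^sup>2 - 1)"
    using False by (simp add: bernoulli_gf_def powers q4)
  also have "\<dots> = (4 * t - 2 * t * (q\<^sup>2 + 1)) / ((q\<^sup>2 - 1) * (q\<^sup>2 + 1))"
    using q2 by (simp add: diff_divide_distrib)
  also have "4 * t - 2 * t * (q\<^sup>2 + 1) = (- 2 * t) * (q\<^sup>2 - 1)"
    by (simp add: algebra_simps)
  also have "(- 2 * t) * (q\<^sup>2 - 1) / ((q\<^sup>2 - 1) * (q\<^sup>2 + 1)) = - 2 * t / (q\<^sup>2 + 1)"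
    using q2 by simp
  also have "\<dots> = t * ((q\<^sup>2 - 1) / (q\<^sup>2 + 1)) - t"
    using q2 by (simp add: field_simps)
  also have "(q\<^sup>2 - 1) / (q\<^sup>2 + 1) = (1 / cosh t) * sinh t"
  proof -
    have "cosh t = (q\<^sup>2 + 1) / (2 * q)" "sinh t = (q\<^sup>2 - 1) / (2 * q)"
      using q by (simp_all add: cosh_def sinh_def powers flip: q_def)
        (simp_all add: field_simps power2_eq_square)
    then show ?thesis
      using q q2 by simp
  qed
  finally show ?thesis .
qed

definition fps_sinh :: "real fps"
  where "fps_sinh = fps_const (1 / 2) * (fps_exp 1 - fps_exp (- 1))"

lemma sinh_has_fps_expansion: "sinh has_fps_expansion fps_sinh"
proof -
  have "(\<lambda>t :: real. 1 / 2 * (exp t - exp (- t))) has_fps_expansion fps_sinh"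
    unfolding fps_sinh_def by (intro fps_expansion_intros)
  also have "(\<lambda>t :: real. 1 / 2 * (exp t - exp (- t))) = sinh"
    by (simp add: sinh_def fun_eq_iff)
  finally show ?thesis .
qed

lemma fps_sinh_nth: "fps_nth fps_sinh k = (if odd k then 1 / fact k else 0)"
  by (simp add: fps_sinh_def)

text \<open>
  At odd degree only the even-indexed \<open>a\<close> meet an odd coefficient of \<open>sinh\<close>, and the
  factorials of the two series combine to a binomial coefficient.
\<close>

lemma egf_times_sinh_nth:
  fixes a :: "nat \<Rightarrow> real"
  assumes "n \<ge> 1"
  shows "fps_nth (Abs_fps (\<lambda>m. a m / fact m) * fps_sinh) (2 * n - 1) =
    (\<Sum>k=0..n-1. real ((2 * n - 1) choose (2 * k)) * a (2 * k)) / fact (2 * n - 1)"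
proof -
  define N where "N = 2 * n - 1"
  have N: "odd N" "N = Suc (2 * (n - 1))"
    using assms by (auto simp: N_def)
  have "fps_nth (Abs_fps (\<lambda>m. a m / fact m) * fps_sinh) N
      = (\<Sum>i=0..N. a i / fact i * fps_nth fps_sinh (N - i))"
    by (simp add: fps_mult_nth)
  also have "\<dots> = (\<Sum>i\<in>(\<lambda>k. 2 * k) ` {0..n-1}. a i / fact i * fps_nth fps_sinh (N - i))"
  proof (rule sum.mono_neutral_right)
    show "\<forall>i\<in>{0..N} - (\<lambda>k. 2 * k) ` {0..n-1}. a i / fact i * fps_nth fps_sinh (N - i) = 0"
    proof
      fix i
      assume i: "i \<in> {0..N} - (\<lambda>k. 2 * k) ` {0..n-1}"
      have "odd i"
      proof
        assume "even i"
        then obtain k where "i = 2 * k" by blast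
        with i N(2) show False by auto
      qed
      with i N(1) show "a i / fact i * fps_nth fps_sinh (N - i) = 0"
        by (simp add: fps_sinh_nth)
    qed
  qed (use N(2) in auto)
  also have "\<dots> = (\<Sum>k=0..n-1. a (2 * k) / fact (2 * k) * fps_nth fps_sinh (N - 2 * k))"
    by (subst sum.reindex) (auto simp: inj_on_def)
  also have "\<dots> = (\<Sum>k=0..n-1. real (N choose (2 * k)) * a (2 * k) / fact N)"
  proof (rule sum.cong)
    fix k
    assume "k \<in> {0..n-1}"
    then have k: "2 * k \<le> N" using N(2) by auto
    then have "odd (N - 2 * k)" using N(1) by simp
    with k show "a (2 * k) / fact (2 * k) * fps_nth fps_sinh (N - 2 * k)
        = real (N choose (2 * k)) * a (2 * k) / fact N"
      by (simp add: fps_sinh_nth binomial_fact)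
  qed simp
  finally show ?thesis
    by (simp add: N_def sum_divide_distrib)
qed

theorem theorem1:
  fixes n :: nat
  assumes "n \<ge> 1"
  shows "bernoulli_number (2 * n) =
    real (2 * n) / (2 ^ (2 * n) * (2 ^ (2 * n) - 1)) *
      (\<Sum>k=0..n-1. real ((2 * n - 1) choose (2 * k)) * euler_number (2 * k))"
proof -
  define S where "S = (\<Sum>k=0..n-1. real ((2 * n - 1) choose (2 * k)) * euler_number (2 * k))"
  define b :: "real \<Rightarrow> real fps"
    where "b = (\<lambda>c. Abs_fps (\<lambda>m. c ^ m * bernoulli_number m / fact m))"
  define e where "e = Abs_fps (\<lambda>m. euler_number m / fact m)"
  have b: "(\<lambda>t. bernoulli_gf (c * t)) has_fps_expansion b c" if "c > 0" for c
    unfolding b_def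
    by (rule egf_dilation_has_fps_expansion[of "2 * pi"]) (use that bernoulli_number_sums in auto)
  have e: "(\<lambda>t. 1 / cosh t) has_fps_expansion e"
    using egf_dilation_has_fps_expansion[of "pi / 2" 1 euler_number "\<lambda>t. 1 / cosh t"]
      euler_number_sums by (simp add: e_def)
  have "(\<lambda>t. bernoulli_gf (4 * t) - bernoulli_gf (2 * t)) has_fps_expansion b 4 - b 2"
    by (intro has_fps_expansion_diff b) simp_all
  moreover have "(\<lambda>t. t * ((1 / cosh t) * sinh t) - t)
      has_fps_expansion fps_X * (e * fps_sinh) - fps_X"
    by (intro fps_expansion_intros e sinh_has_fps_expansion)
  ultimately have "b 4 - b 2 = fps_X * (e * fps_sinh) - fps_X"
    unfolding bernoulli_gf_tanh by (rule has_fps_expansion_unique)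
  then have "fps_nth (b 4 - b 2) (2 * n) = fps_nth (fps_X * (e * fps_sinh) - fps_X) (2 * n)"
    by simp
  moreover have "fps_nth (b 4 - b 2) (2 * n)
      = (4 ^ (2 * n) - 2 ^ (2 * n)) * bernoulli_number (2 * n) / fact (2 * n)"
    by (simp add: b_def algebra_simps diff_divide_distrib)
  moreover have "fps_nth (fps_X * (e * fps_sinh) - fps_X) (2 * n) = S / fact (2 * n - 1)"
    using assms egf_times_sinh_nth[OF assms, of euler_number] by (simp add: e_def S_def fps_X_nth)
  ultimately have "(4 ^ (2 * n) - 2 ^ (2 * n)) * bernoulli_number (2 * n) / fact (2 * n)
      = S / fact (2 * n - 1)"
    by simp
  moreover have "(fact (2 * n) :: real) = real (2 * n) * fact (2 * n - 1)"
    using assms by (subst fact_reduce) auto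
  moreover have "A = N * S'" if "A / (N * F) = S' / F" "N \<noteq> 0" "F \<noteq> 0" for A N F S' :: real
    using that by (simp add: divide_simps)
  ultimately have "(4 ^ (2 * n) - 2 ^ (2 * n)) * bernoulli_number (2 * n) = real (2 * n) * S"
    using assms by (metis fact_nonzero mult_eq_0_iff)
  moreover have "(4 :: real) ^ (2 * n) - 2 ^ (2 * n) = 2 ^ (2 * n) * (2 ^ (2 * n) - 1)"
  proof -
    have "(4 :: real) ^ (2 * n) = 2 ^ (2 * n) * 2 ^ (2 * n)"
      by (simp flip: power_mult_distrib)
    then show ?thesis
      by (simp add: algebra_simps)
  qed
  moreover have "(2 :: real) ^ (2 * n) - 1 \<noteq> 0"
  proof -
    have "(1 :: real) < 2 ^ (2 * n)"
      using assms by (intro one_less_power) auto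
    then show ?thesis by simp
  qed
  ultimately show ?thesis
    unfolding S_def[symmetric] by (simp add: field_simps)
qed

end
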